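(* Let $(L,\Delta,\delta_L,\alpha)$ be a Hom-AssCoDer pair and put $$\Delta_C=\Delta-\tau\circ\Delta.$$ Then $(L,\Delta_C,\delta_L,\alpha)$ is a Hom-Lie CoDer pair.
   Context: All vector spaces and tensor products are over a field $\mathbb{K}$ of characteristic $0$. Let $\tau(x\otimes y)=y\otimes x$ and $\xi(x\otimes y\otimes z)=y\otimes z\otimes x$. A Hom-AssCoDer pair $(L,\Delta,\delta_L,\alpha)$ is a vector space $L$ with linear maps $\Delta:L\to L\otimes L$, $\alpha,\delta_L:L\to L$ such that $(\alpha\otimes\Delta)\circ\Delta=(\Delta\otimes\alpha)\circ\Delta$ and $\Delta\circ\delta_L=(\delta_L\otimes\alpha)\circ\Delta+(\alpha\otimes\delta_L)\circ\Delta$. A Hom-Lie CoDer pair $(L,\Delta',\varphi,\alpha)$ is a vector space $L$ with linear maps $\Delta':L\to L\otimes L$, $\alpha,\varphi:L\to L$ such that $\Delta'=-\tau\circ\Delta'$, $(1+\xi+\xi^2)\circ(\alpha\otimes\Delta')\circ\Delta'=0$ and $\Delta'\circ\varphi=(\varphi\otimes\alpha)\circ\Delta'+(\alpha\otimes\varphi)\circ\Delta'$. *)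

theory Defs
  imports "HOL-Algebra.AbelCoset" "Jordan_Normal_Form.Missing_VectorSpace"
begin

locale char_zero_field = field K for K (structure) +
  assumes char_zero: "0 < (n::nat) \<Longrightarrow> [n] \<cdot> \<one> \<noteq> \<zero>"


section \<open>Quotient spaces and free vector spaces\<close>

text \<open>The ring fields \<open>mult\<close> and \<open>one\<close>, which the record type \<open>module\<close> inherits, carry no
  information here and are set to arbitrary values, as in \<open>func_space\<close>.\<close>

definition quotient_space ::
  "('k, 'r) ring_scheme \<Rightarrow> ('k, 'v, 's) module_scheme \<Rightarrow> 'v set \<Rightarrow> ('k, 'v set) module" where
  "quotient_space K V N =
    \<lparr>carrier = a_rcosets\<^bsub>V\<^esub> N,
     mult = (\<lambda>_ _. N),
     one = N,
     zero = N,
     add = set_add V,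
     smult = (\<lambda>a C. \<Union>v\<in>C. N +>\<^bsub>V\<^esub> (a \<odot>\<^bsub>V\<^esub> v))\<rparr>"

definition free_space :: "('k, 'r) ring_scheme \<Rightarrow> 'x set \<Rightarrow> ('k, 'x \<Rightarrow> 'k) module" where
  "free_space K X = (ring.func_space K X)
    \<lparr>carrier := {f \<in> X \<rightarrow>\<^sub>E carrier K. finite {x \<in> X. f x \<noteq> \<zero>\<^bsub>K\<^esub>}}\<rparr>"

definition free_gen :: "('k, 'r) ring_scheme \<Rightarrow> 'x set \<Rightarrow> 'x \<Rightarrow> 'x \<Rightarrow> 'k" where
  "free_gen K X x = (\<lambda>y\<in>X. if y = x then \<one>\<^bsub>K\<^esub> else \<zero>\<^bsub>K\<^esub>)"


section \<open>The tensor product of two vector spaces\<close>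

text \<open>\<open>V \<otimes> W\<close> is the free vector space on \<open>V \<times> W\<close> modulo the subspace spanned by the
  relations that make \<open>(x, y) \<mapsto> x \<otimes> y\<close> bilinear.\<close>

abbreviation tensor_free ::
  "('k, 'r) ring_scheme \<Rightarrow> ('k, 'a, 's) module_scheme \<Rightarrow> ('k, 'b, 't) module_scheme \<Rightarrow>
   ('k, 'a \<times> 'b \<Rightarrow> 'k) module" where
  "tensor_free K V W \<equiv> free_space K (carrier V \<times> carrier W)"

definition tensor_relations ::
  "('k, 'r) ring_scheme \<Rightarrow> ('k, 'a, 's) module_scheme \<Rightarrow> ('k, 'b, 't) module_scheme \<Rightarrow>
   ('a \<times> 'b \<Rightarrow> 'k) set" where
  "tensor_relations K V W =
    (let F = tensor_free K V W; e = (\<lambda>x y. free_gen K (carrier V \<times> carrier W) (x, y)) in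
      {e (x \<oplus>\<^bsub>V\<^esub> x') y \<ominus>\<^bsub>F\<^esub> (e x y \<oplus>\<^bsub>F\<^esub> e x' y) | x x' y.
         x \<in> carrier V \<and> x' \<in> carrier V \<and> y \<in> carrier W} \<union>
      {e x (y \<oplus>\<^bsub>W\<^esub> y') \<ominus>\<^bsub>F\<^esub> (e x y \<oplus>\<^bsub>F\<^esub> e x y') | x y y'.
         x \<in> carrier V \<and> y \<in> carrier W \<and> y' \<in> carrier W} \<union>
      {e (c \<odot>\<^bsub>V\<^esub> x) y \<ominus>\<^bsub>F\<^esub> c \<odot>\<^bsub>F\<^esub> e x y | c x y.
         c \<in> carrier K \<and> x \<in> carrier V \<and> y \<in> carrier W} \<union>
      {e x (c \<odot>\<^bsub>W\<^esub> y) \<ominus>\<^bsub>F\<^esub> c \<odot>\<^bsub>F\<^esub> e x y | c x y.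
         c \<in> carrier K \<and> x \<in> carrier V \<and> y \<in> carrier W})"

definition tensor_null ::
  "('k, 'r) ring_scheme \<Rightarrow> ('k, 'a, 's) module_scheme \<Rightarrow> ('k, 'b, 't) module_scheme \<Rightarrow>
   ('a \<times> 'b \<Rightarrow> 'k) set" where
  "tensor_null K V W = module.span K (tensor_free K V W) (tensor_relations K V W)"

definition tensor ::
  "('k, 'r) ring_scheme \<Rightarrow> ('k, 'a, 's) module_scheme \<Rightarrow> ('k, 'b, 't) module_scheme \<Rightarrow>
   ('k, ('a \<times> 'b \<Rightarrow> 'k) set) module" where
  "tensor K V W = quotient_space K (tensor_free K V W) (tensor_null K V W)"

definition pure_tensor ::
  "('k, 'r) ring_scheme \<Rightarrow> ('k, 'a, 's) module_scheme \<Rightarrow> ('k, 'b, 't) module_scheme \<Rightarrow>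
   'a \<Rightarrow> 'b \<Rightarrow> ('a \<times> 'b \<Rightarrow> 'k) set" where
  "pure_tensor K V W x y =
     tensor_null K V W +>\<^bsub>tensor_free K V W\<^esub> free_gen K (carrier V \<times> carrier W) (x, y)"


section \<open>Linear maps on tensor products\<close>

text \<open>The linear map \<open>V \<otimes> W \<rightarrow> U\<close> induced by a bilinear map \<open>b\<close>. Extensionality only pins
  down the values outside the carrier, on which linearity says nothing.\<close>

definition tensor_lift ::
  "('k, 'r) ring_scheme \<Rightarrow> ('k, 'a, 's) module_scheme \<Rightarrow> ('k, 'b, 't) module_scheme \<Rightarrow>
   ('k, 'c, 'u) module_scheme \<Rightarrow> ('a \<Rightarrow> 'b \<Rightarrow> 'c) \<Rightarrow> ('a \<times> 'b \<Rightarrow> 'k) set \<Rightarrow> 'c" where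
  "tensor_lift K V W U b =
    (THE h. h \<in> extensional (carrier (tensor K V W)) \<and>
            linear_map K (tensor K V W) U h \<and>
            (\<forall>x\<in>carrier V. \<forall>y\<in>carrier W. h (pure_tensor K V W x y) = b x y))"

text \<open>\<open>f \<otimes> g : V \<otimes> W \<rightarrow> V' \<otimes> W'\<close>\<close>

definition tensor_map ::
  "('k, 'r) ring_scheme \<Rightarrow> ('k, 'a, 's) module_scheme \<Rightarrow> ('k, 'b, 't) module_scheme \<Rightarrow>
   ('k, 'c, 'u) module_scheme \<Rightarrow> ('k, 'd, 'v) module_scheme \<Rightarrow> ('a \<Rightarrow> 'c) \<Rightarrow> ('b \<Rightarrow> 'd) \<Rightarrow>
   ('a \<times> 'b \<Rightarrow> 'k) set \<Rightarrow> ('c \<times> 'd \<Rightarrow> 'k) set" where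
  "tensor_map K V W V' W' f g =
     tensor_lift K V W (tensor K V' W') (\<lambda>x y. pure_tensor K V' W' (f x) (g y))"

text \<open>\<open>\<tau> (x \<otimes> y) = y \<otimes> x\<close>\<close>

definition tensor_flip ::
  "('k, 'r) ring_scheme \<Rightarrow> ('k, 'a, 's) module_scheme \<Rightarrow>
   ('a \<times> 'a \<Rightarrow> 'k) set \<Rightarrow> ('a \<times> 'a \<Rightarrow> 'k) set" where
  "tensor_flip K L = tensor_lift K L L (tensor K L L) (\<lambda>x y. pure_tensor K L L y x)"

text \<open>Threefold tensor products are taken to be \<open>L \<otimes> (L \<otimes> L)\<close>; the usual tacit identification of
  \<open>(L \<otimes> L) \<otimes> L\<close> with it is the map \<open>(x \<otimes> y) \<otimes> z \<mapsto> x \<otimes> (y \<otimes> z)\<close>.\<close>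

abbreviation tensor3 ::
  "('k, 'r) ring_scheme \<Rightarrow> ('k, 'a, 's) module_scheme \<Rightarrow>
   ('k, ('a \<times> ('a \<times> 'a \<Rightarrow> 'k) set \<Rightarrow> 'k) set) module" where
  "tensor3 K L \<equiv> tensor K L (tensor K L L)"

abbreviation pure_tensor3 ::
  "('k, 'r) ring_scheme \<Rightarrow> ('k, 'a, 's) module_scheme \<Rightarrow> 'a \<Rightarrow> 'a \<Rightarrow> 'a \<Rightarrow>
   ('a \<times> ('a \<times> 'a \<Rightarrow> 'k) set \<Rightarrow> 'k) set" where
  "pure_tensor3 K L x y z \<equiv> pure_tensor K L (tensor K L L) x (pure_tensor K L L y z)"

definition tensor_assoc ::
  "('k, 'r) ring_scheme \<Rightarrow> ('k, 'a, 's) module_scheme \<Rightarrow>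
   (('a \<times> 'a \<Rightarrow> 'k) set \<times> 'a \<Rightarrow> 'k) set \<Rightarrow> ('a \<times> ('a \<times> 'a \<Rightarrow> 'k) set \<Rightarrow> 'k) set" where
  "tensor_assoc K L =
     tensor_lift K (tensor K L L) L (tensor3 K L)
       (\<lambda>t z. tensor_lift K L L (tensor3 K L) (\<lambda>x y. pure_tensor3 K L x y z) t)"

text \<open>\<open>\<xi> (x \<otimes> y \<otimes> z) = y \<otimes> z \<otimes> x\<close>\<close>

definition tensor_cycle ::
  "('k, 'r) ring_scheme \<Rightarrow> ('k, 'a, 's) module_scheme \<Rightarrow>
   ('a \<times> ('a \<times> 'a \<Rightarrow> 'k) set \<Rightarrow> 'k) set \<Rightarrow> ('a \<times> ('a \<times> 'a \<Rightarrow> 'k) set \<Rightarrow> 'k) set" where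
  "tensor_cycle K L =
     tensor_lift K L (tensor K L L) (tensor3 K L)
       (\<lambda>x t. tensor_lift K L L (tensor3 K L) (\<lambda>y z. pure_tensor3 K L y z x) t)"


section \<open>Coderivation pairs\<close>

text \<open>\<open>\<Delta> \<circ> d = (d \<otimes> \<alpha>) \<circ> \<Delta> + (\<alpha> \<otimes> d) \<circ> \<Delta>\<close>\<close>

definition hom_coderivation ::
  "('k, 'r) ring_scheme \<Rightarrow> ('k, 'a, 's) module_scheme \<Rightarrow>
   ('a \<Rightarrow> ('a \<times> 'a \<Rightarrow> 'k) set) \<Rightarrow> ('a \<Rightarrow> 'a) \<Rightarrow> ('a \<Rightarrow> 'a) \<Rightarrow> bool" where
  "hom_coderivation K L \<Delta> d \<alpha> \<longleftrightarrow>
     (\<forall>x\<in>carrier L. \<Delta> (d x) =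
        tensor_map K L L L L d \<alpha> (\<Delta> x) \<oplus>\<^bsub>tensor K L L\<^esub> tensor_map K L L L L \<alpha> d (\<Delta> x))"

locale hom_asscoder_pair =
  vectorspace K L +
  Delta: linear_map K L "tensor K L L" \<Delta> +
  delta: linear_map K L L \<delta> +
  alpha: linear_map K L L \<alpha>
  for K :: "('k, 'r) ring_scheme" and L :: "('k, 'a, 's) module_scheme" and \<Delta> \<delta> \<alpha> +
  assumes hom_coassociative:
    "x \<in> carrier L \<Longrightarrow>
       tensor_map K L L L (tensor K L L) \<alpha> \<Delta> (\<Delta> x) =
       tensor_assoc K L (tensor_map K L L (tensor K L L) L \<Delta> \<alpha> (\<Delta> x))"
    and coderivation: "hom_coderivation K L \<Delta> \<delta> \<alpha>"

locale hom_lie_coder_pair =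
  vectorspace K L +
  Delta: linear_map K L "tensor K L L" \<Delta> +
  phi: linear_map K L L \<phi> +
  alpha: linear_map K L L \<alpha>
  for K :: "('k, 'r) ring_scheme" and L :: "('k, 'a, 's) module_scheme" and \<Delta> \<phi> \<alpha> +
  assumes skew_symmetric:
    "x \<in> carrier L \<Longrightarrow> \<Delta> x = \<ominus>\<^bsub>tensor K L L\<^esub> tensor_flip K L (\<Delta> x)"
    and hom_co_jacobi:
    "x \<in> carrier L \<Longrightarrow>
       (let t = tensor_map K L L L (tensor K L L) \<alpha> \<Delta> (\<Delta> x)
        in t \<oplus>\<^bsub>tensor3 K L\<^esub> tensor_cycle K L t
             \<oplus>\<^bsub>tensor3 K L\<^esub> tensor_cycle K L (tensor_cycle K L t)) = \<zero>\<^bsub>tensor3 K L\<^esub>"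
    and coderivation: "hom_coderivation K L \<Delta> \<phi> \<alpha>"

definition cocommutator ::
  "('k, 'r) ring_scheme \<Rightarrow> ('k, 'a, 's) module_scheme \<Rightarrow>
   ('a \<Rightarrow> ('a \<times> 'a \<Rightarrow> 'k) set) \<Rightarrow> 'a \<Rightarrow> ('a \<times> 'a \<Rightarrow> 'k) set" where
  "cocommutator K L \<Delta> x = \<Delta> x \<ominus>\<^bsub>tensor K L L\<^esub> tensor_flip K L (\<Delta> x)"

end

theory Submission
  imports Defs
begin

text \<open>Why the cocommutator \<open>\<Delta>\<^sub>C = \<Delta> - \<tau> \<Delta>\<close> is a Hom-Lie comultiplication. Skew-symmetry follows
  from \<open>\<tau>\<^sup>2 = 1\<close>, and the coderivation rule from \<open>\<tau> (f \<otimes> g) = (g \<otimes> f) \<tau>\<close>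
  (\<open>tensor_flip_flip\<close>, \<open>tensor_flip_tensor_map\<close>).

  For the co-Jacobi identity, put \<open>A = (\<alpha> \<otimes> \<Delta>) \<Delta>\<close> and \<open>\<sigma> = 1 \<otimes> \<tau>\<close>. Replacing the inner
  \<open>\<Delta>\<close> by \<open>\<Delta>\<^sub>C\<close> applies \<open>1 - \<sigma>\<close> (\<open>tensor_map_cocommutator\<close>). Replacing the outer one subtracts
  \<open>(\<alpha> \<otimes> \<Delta>) \<tau> \<Delta> = \<xi>\<^sup>2 (\<Delta> \<otimes> \<alpha>) \<Delta>\<close> (\<open>tensor_map_tensor_flip\<close>), which is \<open>\<xi>\<^sup>2 A\<close> by
  coassociativity. Hence \<open>(\<alpha> \<otimes> \<Delta>\<^sub>C) \<Delta>\<^sub>C = (1 - \<sigma>) (1 - \<xi>\<^sup>2) A\<close>, and already in the group algebra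
  of the symmetric group \<open>(1 + \<xi> + \<xi>\<^sup>2) (1 - \<sigma>) (1 - \<xi>\<^sup>2) = 0\<close>
  (\<open>cyclic_sum_alternating\<close>).

  The identities that relate \<open>\<tau>\<close>, \<open>\<xi>\<close>, \<open>\<sigma>\<close> and the maps \<open>f \<otimes> g\<close> to one another are
  checked on pure tensors (\<open>tensor_induct\<close>). What makes this legitimate is the universal property of the tensor product: the maps are given by a definite
  description, which has a meaning only once a unique linear map with the prescribed values on
  pure tensors is known to exist (\<open>tensor_lift_welldefined\<close>). It is assembled from the universal
  properties of free spaces (\<open>free_space_lift\<close>) and of quotients (\<open>quotient_space_lift\<close>).\<close>


section \<open>Linear maps\<close>

lemma linear_mapI:
  assumes "vectorspace K V" and "vectorspace K W"
    and "\<And>x. x \<in> carrier V \<Longrightarrow> f x \<in> carrier W"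
    and "\<And>x y. x \<in> carrier V \<Longrightarrow> y \<in> carrier V \<Longrightarrow> f (x \<oplus>\<^bsub>V\<^esub> y) = f x \<oplus>\<^bsub>W\<^esub> f y"
    and "\<And>c x. c \<in> carrier K \<Longrightarrow> x \<in> carrier V \<Longrightarrow> f (c \<odot>\<^bsub>V\<^esub> x) = c \<odot>\<^bsub>W\<^esub> f x"
  shows "linear_map K V W f"
  using assms
  unfolding linear_map_def mod_hom_def mod_hom_axioms_def module_hom_def vectorspace_def
  by auto

lemma linear_map_cong:
  assumes "linear_map K V W f" and "\<And>x. x \<in> carrier V \<Longrightarrow> g x = f x"
  shows "linear_map K V W g"
proof -
  interpret linear_map K V W f by fact
  show ?thesis
    by (rule linear_mapI) (auto simp: assms(2) V.vectorspace_axioms W.vectorspace_axioms)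
qed

lemma linear_map_ident: "vectorspace K V \<Longrightarrow> linear_map K V V (\<lambda>x. x)"
  by (rule linear_mapI) auto

lemma linear_map_comp:
  assumes "linear_map K U V f" and "linear_map K V W g"
  shows "linear_map K U W (\<lambda>x. g (f x))"
proof -
  interpret f: linear_map K U V f by fact
  interpret g: linear_map K V W g by fact
  show ?thesis
    by (rule linear_mapI) (auto simp: f.V.vectorspace_axioms g.W.vectorspace_axioms)
qed

lemma linear_map_add:
  assumes "linear_map K V W f" and "linear_map K V W g"
  shows "linear_map K V W (\<lambda>x. f x \<oplus>\<^bsub>W\<^esub> g x)"
proof -
  interpret V: vectorspace K V using assms(1) by (simp add: linear_map_def)
  interpret W: vectorspace K W using assms(1) by (simp add: linear_map_def)
  interpret f: linear_map K V W f by fact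
  interpret g: linear_map K V W g by fact
  show ?thesis
    by (rule linear_mapI)
      (auto simp: V.vectorspace_axioms W.vectorspace_axioms W.a_ac W.smult_r_distr)
qed

lemma linear_map_minus:
  assumes "linear_map K V W f" and "linear_map K V W g"
  shows "linear_map K V W (\<lambda>x. f x \<ominus>\<^bsub>W\<^esub> g x)"
proof -
  interpret V: vectorspace K V using assms(1) by (simp add: linear_map_def)
  interpret W: vectorspace K W using assms(1) by (simp add: linear_map_def)
  interpret f: linear_map K V W f by fact
  interpret g: linear_map K V W g by fact
  show ?thesis
    by (rule linear_mapI)
      (auto simp: V.vectorspace_axioms W.vectorspace_axioms a_minus_def W.minus_add W.a_ac
        W.smult_r_distr W.smult_r_minus)
qed

section \<open>Quotient spaces\<close>

context
  fixes K :: "('k, 'r) ring_scheme" and V :: "('k, 'v, 's) module_scheme" and N :: "'v set"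
  assumes V: "vectorspace K V" and N: "submodule K N V"
begin

interpretation V: vectorspace K V by (rule V)
interpretation N: submodule K N V by (rule N)

lemma submodule_abelian_subgroup: "abelian_subgroup N V"
proof (rule abelian_subgroupI3)
  have "\<ominus>\<^bsub>V\<^esub> v \<in> N" if v: "v \<in> N" for v
  proof -
    have "\<ominus>\<^bsub>K\<^esub> \<one>\<^bsub>K\<^esub> \<odot>\<^bsub>V\<^esub> v \<in> N"
      using V.R.add.inv_closed[OF V.one_closed] v by (rule N.smult_closed)
    also have "\<ominus>\<^bsub>K\<^esub> \<one>\<^bsub>K\<^esub> \<odot>\<^bsub>V\<^esub> v = \<ominus>\<^bsub>V\<^esub> v"
      using v N.subset by (intro V.smult_minus_1) auto
    finally show ?thesis .
  qed
  then show "additive_subgroup N V"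
    using N.subset by (intro additive_subgroupI subgroup.intro) (auto simp flip: a_inv_def)
qed (rule V.abelian_group_axioms)

interpretation N: abelian_subgroup N V by (rule submodule_abelian_subgroup)

lemma carrier_quotient_space: "carrier (quotient_space K V N) = (\<lambda>v. N +>\<^bsub>V\<^esub> v) ` carrier V"
  by (auto simp: quotient_space_def A_RCOSETS_def' a_r_coset_def')

lemma coset_eqI:
  assumes v: "v \<in> carrier V" and w: "w \<in> carrier V" and diff: "w \<ominus>\<^bsub>V\<^esub> v \<in> N"
  shows "N +>\<^bsub>V\<^esub> w = N +>\<^bsub>V\<^esub> v"
proof -
  have "w \<in> N +>\<^bsub>V\<^esub> v"
    using v w diff unfolding a_minus_def by (rule N.a_rcos_module_rev)
  then show ?thesis
    using v by (rule N.a_repr_independence'[symmetric])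
qed

lemma quotient_space_add:
  "v \<in> carrier V \<Longrightarrow> w \<in> carrier V \<Longrightarrow>
   (N +>\<^bsub>V\<^esub> v) \<oplus>\<^bsub>quotient_space K V N\<^esub> (N +>\<^bsub>V\<^esub> w) = N +>\<^bsub>V\<^esub> (v \<oplus>\<^bsub>V\<^esub> w)"
  by (simp add: quotient_space_def N.a_rcos_sum)

text \<open>The defining union runs over all representatives of the coset; it collapses to one coset
  because \<open>c \<odot> w\<close> and \<open>c \<odot> v\<close> differ by an element of \<open>N\<close> whenever \<open>w\<close> and \<open>v\<close> do.\<close>

lemma quotient_space_smult:
  assumes c: "c \<in> carrier K" and v: "v \<in> carrier V"
  shows "c \<odot>\<^bsub>quotient_space K V N\<^esub> (N +>\<^bsub>V\<^esub> v) = N +>\<^bsub>V\<^esub> (c \<odot>\<^bsub>V\<^esub> v)"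
proof -
  have indep: "N +>\<^bsub>V\<^esub> (c \<odot>\<^bsub>V\<^esub> w) = N +>\<^bsub>V\<^esub> (c \<odot>\<^bsub>V\<^esub> v)" if "w \<in> N +>\<^bsub>V\<^esub> v" for w
  proof -
    have w: "w \<in> carrier V"
      using that v N.a_elemrcos_carrier by blast
    have "w \<ominus>\<^bsub>V\<^esub> v \<in> N"
      using that v by (simp add: a_minus_def N.a_rcos_module_imp)
    then have "c \<odot>\<^bsub>V\<^esub> (w \<ominus>\<^bsub>V\<^esub> v) \<in> N"
      using c by blast
    also have "c \<odot>\<^bsub>V\<^esub> (w \<ominus>\<^bsub>V\<^esub> v) = c \<odot>\<^bsub>V\<^esub> w \<ominus>\<^bsub>V\<^esub> c \<odot>\<^bsub>V\<^esub> v"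
      using c v w by (simp add: a_minus_def V.smult_r_distr V.smult_r_minus)
    finally show ?thesis
      using c v w by (intro coset_eqI) simp_all
  qed
  have "(\<Union>w\<in>N +>\<^bsub>V\<^esub> v. N +>\<^bsub>V\<^esub> (c \<odot>\<^bsub>V\<^esub> w)) = N +>\<^bsub>V\<^esub> (c \<odot>\<^bsub>V\<^esub> v)"
  proof (rule SUP_eq_const)
    show "N +>\<^bsub>V\<^esub> v \<noteq> {}"
      using N.a_rcos_self[OF v] by blast
  qed (rule indep)
  then show ?thesis
    by (simp add: quotient_space_def)
qed

lemma quotient_space_zero: "\<zero>\<^bsub>quotient_space K V N\<^esub> = N +>\<^bsub>V\<^esub> \<zero>\<^bsub>V\<^esub>"
  by (simp add: quotient_space_def N.a_rcos_const)

lemma coset_closed: "v \<in> carrier V \<Longrightarrow> N +>\<^bsub>V\<^esub> v \<in> carrier (quotient_space K V N)"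
  unfolding carrier_quotient_space by (rule imageI)

lemma quotient_spaceE:
  assumes "C \<in> carrier (quotient_space K V N)"
  obtains v where "v \<in> carrier V" and "C = N +>\<^bsub>V\<^esub> v"
  using assms unfolding carrier_quotient_space by blast

lemma vectorspace_quotient_space: "vectorspace K (quotient_space K V N)"
proof -
  let ?Q = "quotient_space K V N"
  note simps = coset_closed quotient_space_add quotient_space_smult quotient_space_zero
  have zero: "\<zero>\<^bsub>?Q\<^esub> \<in> carrier ?Q"
    by (simp add: simps)
  have add: "C \<oplus>\<^bsub>?Q\<^esub> D \<in> carrier ?Q" and comm: "C \<oplus>\<^bsub>?Q\<^esub> D = D \<oplus>\<^bsub>?Q\<^esub> C"
    if "C \<in> carrier ?Q" "D \<in> carrier ?Q" for C D
    using that by (elim quotient_spaceE; simp add: simps V.a_comm)+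
  have assoc: "C \<oplus>\<^bsub>?Q\<^esub> D \<oplus>\<^bsub>?Q\<^esub> E = C \<oplus>\<^bsub>?Q\<^esub> (D \<oplus>\<^bsub>?Q\<^esub> E)"
    if "C \<in> carrier ?Q" "D \<in> carrier ?Q" "E \<in> carrier ?Q" for C D E
    using that by (elim quotient_spaceE) (simp add: simps V.a_assoc)
  have zero_add: "\<zero>\<^bsub>?Q\<^esub> \<oplus>\<^bsub>?Q\<^esub> C = C" and one: "\<one>\<^bsub>K\<^esub> \<odot>\<^bsub>?Q\<^esub> C = C"
    and neg: "\<exists>D\<in>carrier ?Q. D \<oplus>\<^bsub>?Q\<^esub> C = \<zero>\<^bsub>?Q\<^esub>"
    if "C \<in> carrier ?Q" for C
  proof -
    obtain v where v: "v \<in> carrier V" "C = N +>\<^bsub>V\<^esub> v"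
      using \<open>C \<in> carrier ?Q\<close> by (rule quotient_spaceE)
    show "\<zero>\<^bsub>?Q\<^esub> \<oplus>\<^bsub>?Q\<^esub> C = C" and "\<one>\<^bsub>K\<^esub> \<odot>\<^bsub>?Q\<^esub> C = C"
      using v by (simp_all add: simps)
    show "\<exists>D\<in>carrier ?Q. D \<oplus>\<^bsub>?Q\<^esub> C = \<zero>\<^bsub>?Q\<^esub>"
      using v by (intro bexI[of _ "N +>\<^bsub>V\<^esub> (\<ominus>\<^bsub>V\<^esub> v)"]) (simp_all add: simps V.l_neg)
  qed
  have smult: "a \<odot>\<^bsub>?Q\<^esub> C \<in> carrier ?Q" if "a \<in> carrier K" "C \<in> carrier ?Q" for a C
    using that by (elim quotient_spaceE) (simp add: simps)
  have smult_add: "a \<odot>\<^bsub>?Q\<^esub> (C \<oplus>\<^bsub>?Q\<^esub> D) = a \<odot>\<^bsub>?Q\<^esub> C \<oplus>\<^bsub>?Q\<^esub> a \<odot>\<^bsub>?Q\<^esub> D"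
    if "a \<in> carrier K" "C \<in> carrier ?Q" "D \<in> carrier ?Q" for a C D
    using that by (elim quotient_spaceE) (simp add: simps V.smult_r_distr)
  have add_smult: "(a \<oplus>\<^bsub>K\<^esub> b) \<odot>\<^bsub>?Q\<^esub> C = a \<odot>\<^bsub>?Q\<^esub> C \<oplus>\<^bsub>?Q\<^esub> b \<odot>\<^bsub>?Q\<^esub> C"
    and mult_smult: "(a \<otimes>\<^bsub>K\<^esub> b) \<odot>\<^bsub>?Q\<^esub> C = a \<odot>\<^bsub>?Q\<^esub> (b \<odot>\<^bsub>?Q\<^esub> C)"
    if "a \<in> carrier K" "b \<in> carrier K" "C \<in> carrier ?Q" for a b C
    using that by (elim quotient_spaceE; simp add: simps V.smult_l_distr V.smult_assoc1)+
  show ?thesis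
    by (intro vectorspace.intro V.field_axioms moduleI[OF V.R.is_cring abelian_groupI])
      (fact add zero assoc comm zero_add neg smult add_smult smult_add mult_smult one)+
qed

lemma linear_map_coset: "linear_map K V (quotient_space K V N) (\<lambda>v. N +>\<^bsub>V\<^esub> v)"
  using V vectorspace_quotient_space
  by (rule linear_mapI) (simp_all add: coset_closed quotient_space_add quotient_space_smult)

text \<open>The universal property of \<open>V / N\<close>: any choice of representatives gives the induced map,
  since \<open>f\<close> is constant on cosets.\<close>

lemma quotient_space_lift:
  assumes f: "linear_map K V W f" and ker: "\<And>n. n \<in> N \<Longrightarrow> f n = \<zero>\<^bsub>W\<^esub>"
  obtains g where "linear_map K (quotient_space K V N) W g"
    and "\<And>v. v \<in> carrier V \<Longrightarrow> g (N +>\<^bsub>V\<^esub> v) = f v"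
proof -
  interpret f: linear_map K V W f by (rule f)
  define g where "g C = f (SOME v. v \<in> C)" for C
  have g: "g (N +>\<^bsub>V\<^esub> v) = f v" if v: "v \<in> carrier V" for v
  proof -
    define w where "w = (SOME w. w \<in> N +>\<^bsub>V\<^esub> v)"
    have mem: "w \<in> N +>\<^bsub>V\<^esub> v"
      unfolding w_def using N.a_rcos_self[OF v] by (rule someI)
    have w: "w \<in> carrier V"
      using mem v N.a_elemrcos_carrier by blast
    have "w \<ominus>\<^bsub>V\<^esub> v \<in> N"
      using mem v by (simp add: a_minus_def N.a_rcos_module_imp)
    then have "f w \<ominus>\<^bsub>W\<^esub> f v = \<zero>\<^bsub>W\<^esub>"
      using ker[of "w \<ominus>\<^bsub>V\<^esub> v"] w v by simp
    then show ?thesis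
      using v w by (simp add: g_def flip: w_def)
  qed
  show thesis
  proof (rule that[OF _ g])
    show "linear_map K (quotient_space K V N) W g"
      using vectorspace_quotient_space f.W.vectorspace_axioms
      by (rule linear_mapI)
        (elim quotient_spaceE, simp add: g quotient_space_add quotient_space_smult)+
  qed
qed

end


section \<open>Free vector spaces\<close>

context
  fixes K :: "('k, 'r) ring_scheme" and X :: "'x set"
  assumes K: "field K"
begin

interpretation K: field K by (rule K)

lemma carrier_free_space:
  "f \<in> carrier (free_space K X) \<longleftrightarrow> f \<in> X \<rightarrow>\<^sub>E carrier K \<and> finite {x \<in> X. f x \<noteq> \<zero>\<^bsub>K\<^esub>}"
  by (simp add: free_space_def)

lemma free_space_add: "f \<oplus>\<^bsub>free_space K X\<^esub> g = (\<lambda>x\<in>X. f x \<oplus>\<^bsub>K\<^esub> g x)"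
  by (simp add: free_space_def K.func_space_def)

lemma free_space_smult: "c \<odot>\<^bsub>free_space K X\<^esub> f = (\<lambda>x\<in>X. c \<otimes>\<^bsub>K\<^esub> f x)"
  by (simp add: free_space_def K.func_space_def)

lemma free_space_zero: "\<zero>\<^bsub>free_space K X\<^esub> = (\<lambda>x\<in>X. \<zero>\<^bsub>K\<^esub>)"
  by (simp add: free_space_def K.func_space_def)

lemma vectorspace_free_space: "vectorspace K (free_space K X)"
proof (rule vectorspace.intro)
  interpret F: module K "ring.func_space K X" by (rule K.func_space_is_module)
  let ?S = "{f \<in> X \<rightarrow>\<^sub>E carrier K. finite {x \<in> X. f x \<noteq> \<zero>\<^bsub>K\<^esub>}}"
  have "submodule K ?S (ring.func_space K X)"
  proof (rule submodule.intro)
    fix f g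
    assume fg: "f \<in> ?S" "g \<in> ?S"
    have "{x \<in> X. f x \<oplus>\<^bsub>K\<^esub> g x \<noteq> \<zero>\<^bsub>K\<^esub>} \<subseteq>
        {x \<in> X. f x \<noteq> \<zero>\<^bsub>K\<^esub>} \<union> {x \<in> X. g x \<noteq> \<zero>\<^bsub>K\<^esub>}"
      by auto
    then have "finite {x \<in> X. f x \<oplus>\<^bsub>K\<^esub> g x \<noteq> \<zero>\<^bsub>K\<^esub>}"
      using fg by (elim finite_subset) simp
    moreover have "(\<lambda>x\<in>X. f x \<oplus>\<^bsub>K\<^esub> g x) \<in> X \<rightarrow>\<^sub>E carrier K"
      using fg by (auto simp: PiE_iff)
    ultimately show "f \<oplus>\<^bsub>ring.func_space K X\<^esub> g \<in> ?S"
      by (simp add: K.func_space_def cong: conj_cong)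
  next
    fix c f
    assume c: "c \<in> carrier K" and f: "f \<in> ?S"
    have "{x \<in> X. c \<otimes>\<^bsub>K\<^esub> f x \<noteq> \<zero>\<^bsub>K\<^esub>} \<subseteq> {x \<in> X. f x \<noteq> \<zero>\<^bsub>K\<^esub>}"
      using c by auto
    then have "finite {x \<in> X. c \<otimes>\<^bsub>K\<^esub> f x \<noteq> \<zero>\<^bsub>K\<^esub>}"
      using f by (elim finite_subset) simp
    moreover have "(\<lambda>x\<in>X. c \<otimes>\<^bsub>K\<^esub> f x) \<in> X \<rightarrow>\<^sub>E carrier K"
      using c f by (auto simp: PiE_iff)
    ultimately show "c \<odot>\<^bsub>ring.func_space K X\<^esub> f \<in> ?S"
      by (simp add: K.func_space_def cong: conj_cong)
  qed (rule F.module_axioms, auto simp: K.func_space_def)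
  then show "module K (free_space K X)"
    unfolding free_space_def by (rule F.submodule_is_module)
qed (rule K)

interpretation F: vectorspace K "free_space K X" by (rule vectorspace_free_space)

lemma free_gen_closed: "free_gen K X x \<in> carrier (free_space K X)"
proof -
  have "{y \<in> X. free_gen K X x y \<noteq> \<zero>\<^bsub>K\<^esub>} \<subseteq> {x}"
    by (auto simp: free_gen_def split: if_splits)
  then have "finite {y \<in> X. free_gen K X x y \<noteq> \<zero>\<^bsub>K\<^esub>}"
    by (rule finite_subset) simp
  then show ?thesis
    by (simp add: carrier_free_space) (simp add: free_gen_def)
qed

text \<open>The generators span: induction on the support, one coordinate \<open>a\<close> being split off at
  a time as \<open>f a \<odot> e\<^sub>a\<close>.\<close>

lemma free_space_induct [consumes 1, case_names zero add]:
  assumes f: "f \<in> carrier (free_space K X)"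
    and zero: "P \<zero>\<^bsub>free_space K X\<^esub>"
    and add: "\<And>c x g. c \<in> carrier K \<Longrightarrow> x \<in> X \<Longrightarrow> g \<in> carrier (free_space K X) \<Longrightarrow> P g \<Longrightarrow>
      P (c \<odot>\<^bsub>free_space K X\<^esub> free_gen K X x \<oplus>\<^bsub>free_space K X\<^esub> g)"
  shows "P f"
proof -
  have "P f" if "finite A" "f \<in> carrier (free_space K X)" "{x \<in> X. f x \<noteq> \<zero>\<^bsub>K\<^esub>} = A" for A f
    using that
  proof (induction A arbitrary: f rule: finite_induct)
    case empty
    then have "f = \<zero>\<^bsub>free_space K X\<^esub>"
      by (intro extensionalityI[of _ X]) (auto simp: carrier_free_space free_space_zero PiE_iff)
    then show ?case
      using zero by simp
  next
    case (insert a A)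
    define g where "g = f(a := \<zero>\<^bsub>K\<^esub>)"
    have a: "a \<in> X" "f a \<in> carrier K"
      using insert.prems by (auto simp: carrier_free_space)
    have supp: "{x \<in> X. g x \<noteq> \<zero>\<^bsub>K\<^esub>} = A"
      using insert.prems insert.hyps by (auto simp: g_def)
    have g: "g \<in> carrier (free_space K X)"
      using insert.prems insert.hyps a supp
      by (auto simp: carrier_free_space g_def PiE_iff extensional_def)
    have "f = f a \<odot>\<^bsub>free_space K X\<^esub> free_gen K X a \<oplus>\<^bsub>free_space K X\<^esub> g"
    proof (rule extensionalityI[of _ X])
      fix x
      assume "x \<in> X"
      then have "f x \<in> carrier K"
        using insert.prems(1) by (auto simp: carrier_free_space)
      then show "f x = (f a \<odot>\<^bsub>free_space K X\<^esub> free_gen K X a \<oplus>\<^bsub>free_space K X\<^esub> g) x"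
        using \<open>x \<in> X\<close> a by (simp add: free_space_add free_space_smult free_gen_def g_def)
    qed (use insert.prems(1) in \<open>simp_all add: carrier_free_space free_space_add PiE_iff\<close>)
    then show ?case
      using add[OF a(2,1) g insert.IH[OF g supp]] by simp
  qed
  then show ?thesis
    using f by (auto simp: carrier_free_space)
qed

text \<open>The universal property: \<open>h f = (\<Sum>x. f x \<odot> b x)\<close>. The sum has to be restricted to the
  support of \<open>f\<close>, which varies with \<open>f\<close>; additivity therefore compares the sums
  over a common finite set containing the supports.\<close>

lemma free_space_lift:
  assumes U: "vectorspace K U" and b: "\<And>x. x \<in> X \<Longrightarrow> b x \<in> carrier U"
  obtains h where "linear_map K (free_space K X) U h"
    and "\<And>x. x \<in> X \<Longrightarrow> h (free_gen K X x) = b x"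
proof -
  interpret U: vectorspace K U by (rule U)
  define h where "h f = (\<Oplus>\<^bsub>U\<^esub>x\<in>{x \<in> X. f x \<noteq> \<zero>\<^bsub>K\<^esub>}. f x \<odot>\<^bsub>U\<^esub> b x)" for f
  have h: "h f = (\<Oplus>\<^bsub>U\<^esub>x\<in>A. f x \<odot>\<^bsub>U\<^esub> b x)"
    if "f \<in> carrier (free_space K X)" "finite A" "A \<subseteq> X" "{x \<in> X. f x \<noteq> \<zero>\<^bsub>K\<^esub>} \<subseteq> A" for f A
  proof -
    have "f x \<odot>\<^bsub>U\<^esub> b x \<in> carrier U" if "x \<in> A" for x
      using that \<open>A \<subseteq> X\<close> \<open>f \<in> carrier (free_space K X)\<close>
      by (intro U.smult_closed b) (auto simp: carrier_free_space)
    moreover have "f x \<odot>\<^bsub>U\<^esub> b x = \<zero>\<^bsub>U\<^esub>" if "x \<in> A - {x \<in> X. f x \<noteq> \<zero>\<^bsub>K\<^esub>}" for x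
      using that \<open>A \<subseteq> X\<close> by (auto simp: b)
    ultimately show ?thesis
      unfolding h_def using \<open>finite A\<close> that(4)
      by (intro U.add.finprod_mono_neutral_cong_left) auto
  qed
  show thesis
  proof
    show "linear_map K (free_space K X) U h"
    proof (rule linear_mapI[OF vectorspace_free_space U])
      fix f
      assume f: "f \<in> carrier (free_space K X)"
      have "f x \<odot>\<^bsub>U\<^esub> b x \<in> carrier U" if "x \<in> X" for x
        using that f by (intro U.smult_closed b) (auto simp: carrier_free_space)
      then show "h f \<in> carrier U"
        unfolding h_def by (intro U.finsum_closed) simp
    next
      fix f g
      assume f: "f \<in> carrier (free_space K X)" and g: "g \<in> carrier (free_space K X)"
      define A where "A = {x \<in> X. f x \<noteq> \<zero>\<^bsub>K\<^esub>} \<union> {x \<in> X. g x \<noteq> \<zero>\<^bsub>K\<^esub>}"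
      have A: "finite A" "A \<subseteq> X" "{x \<in> X. f x \<noteq> \<zero>\<^bsub>K\<^esub>} \<subseteq> A" "{x \<in> X. g x \<noteq> \<zero>\<^bsub>K\<^esub>} \<subseteq> A"
        using f g by (auto simp: A_def carrier_free_space)
      have bA: "b x \<in> carrier U" if "x \<in> A" for x
        using b A(2) that by blast
      have fg: "f x \<in> carrier K" "g x \<in> carrier K" if "x \<in> A" for x
        using f g A that by (auto simp: carrier_free_space)
      have "h (f \<oplus>\<^bsub>free_space K X\<^esub> g)
          = (\<Oplus>\<^bsub>U\<^esub>x\<in>A. (f \<oplus>\<^bsub>free_space K X\<^esub> g) x \<odot>\<^bsub>U\<^esub> b x)"
        using A(1,2) by (intro h F.add.m_closed f g) (auto simp: free_space_add A_def)
      also have "\<dots> = (\<Oplus>\<^bsub>U\<^esub>x\<in>A. f x \<odot>\<^bsub>U\<^esub> b x \<oplus>\<^bsub>U\<^esub> g x \<odot>\<^bsub>U\<^esub> b x)"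
      proof (rule U.finsum_cong')
        show "(\<lambda>x. f x \<odot>\<^bsub>U\<^esub> b x \<oplus>\<^bsub>U\<^esub> g x \<odot>\<^bsub>U\<^esub> b x) \<in> A \<rightarrow> carrier U"
          using fg bA by simp
        show "(f \<oplus>\<^bsub>free_space K X\<^esub> g) x \<odot>\<^bsub>U\<^esub> b x = f x \<odot>\<^bsub>U\<^esub> b x \<oplus>\<^bsub>U\<^esub> g x \<odot>\<^bsub>U\<^esub> b x"
          if "x \<in> A" for x
          using that fg bA A(2) by (simp add: free_space_add U.smult_l_distr subsetD)
      qed simp
      also have "\<dots> = (\<Oplus>\<^bsub>U\<^esub>x\<in>A. f x \<odot>\<^bsub>U\<^esub> b x) \<oplus>\<^bsub>U\<^esub> (\<Oplus>\<^bsub>U\<^esub>x\<in>A. g x \<odot>\<^bsub>U\<^esub> b x)"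
        using fg bA by (intro U.finsum_addf) simp_all
      finally show "h (f \<oplus>\<^bsub>free_space K X\<^esub> g) = h f \<oplus>\<^bsub>U\<^esub> h g"
        using A f g by (simp add: h)
    next
      fix c f
      assume c: "c \<in> carrier K" and f: "f \<in> carrier (free_space K X)"
      define A where "A = {x \<in> X. f x \<noteq> \<zero>\<^bsub>K\<^esub>}"
      have A: "finite A" "A \<subseteq> X" "{x \<in> X. f x \<noteq> \<zero>\<^bsub>K\<^esub>} \<subseteq> A"
        using f by (auto simp: A_def carrier_free_space)
      have bA: "b x \<in> carrier U" if "x \<in> A" for x
        using b A(2) that by blast
      have fA: "f x \<in> carrier K" if "x \<in> A" for x
        using f A that by (auto simp: carrier_free_space)
      have "h (c \<odot>\<^bsub>free_space K X\<^esub> f) = (\<Oplus>\<^bsub>U\<^esub>x\<in>A. (c \<odot>\<^bsub>free_space K X\<^esub> f) x \<odot>\<^bsub>U\<^esub> b x)"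
        using A(1,2) c by (intro h F.smult_closed c f) (auto simp: free_space_smult A_def)
      also have "\<dots> = (\<Oplus>\<^bsub>U\<^esub>x\<in>A. c \<odot>\<^bsub>U\<^esub> (f x \<odot>\<^bsub>U\<^esub> b x))"
      proof (rule U.finsum_cong')
        show "(\<lambda>x. c \<odot>\<^bsub>U\<^esub> (f x \<odot>\<^bsub>U\<^esub> b x)) \<in> A \<rightarrow> carrier U"
          using c fA bA by simp
        show "(c \<odot>\<^bsub>free_space K X\<^esub> f) x \<odot>\<^bsub>U\<^esub> b x = c \<odot>\<^bsub>U\<^esub> (f x \<odot>\<^bsub>U\<^esub> b x)" if "x \<in> A" for x
          using that c fA bA A(2) by (simp add: free_space_smult U.smult_assoc1 subsetD)
      qed simp
      also have "\<dots> = c \<odot>\<^bsub>U\<^esub> (\<Oplus>\<^bsub>U\<^esub>x\<in>A. f x \<odot>\<^bsub>U\<^esub> b x)"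
        using A(1) c fA bA by (intro U.finsum_smult_ldistr[symmetric]) simp_all
      finally show "h (c \<odot>\<^bsub>free_space K X\<^esub> f) = c \<odot>\<^bsub>U\<^esub> h f"
        using A f by (simp add: h)
    qed
  next
    fix x
    assume x: "x \<in> X"
    have "h (free_gen K X x) = (\<Oplus>\<^bsub>U\<^esub>y\<in>{x}. free_gen K X x y \<odot>\<^bsub>U\<^esub> b y)"
      using x by (intro h free_gen_closed) (auto simp: free_gen_def split: if_splits)
    then show "h (free_gen K X x) = b x"
      using x b by (simp add: free_gen_def)
  qed
qed

end


section \<open>The universal property of the tensor product\<close>

definition bilinear_map ::
  "('k, 'r) ring_scheme \<Rightarrow> ('k, 'a, 's) module_scheme \<Rightarrow> ('k, 'b, 't) module_scheme \<Rightarrow>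
   ('k, 'c, 'u) module_scheme \<Rightarrow> ('a \<Rightarrow> 'b \<Rightarrow> 'c) \<Rightarrow> bool" where
  "bilinear_map K V W U b \<longleftrightarrow>
     (\<forall>y\<in>carrier W. linear_map K V U (\<lambda>x. b x y)) \<and>
     (\<forall>x\<in>carrier V. linear_map K W U (\<lambda>y. b x y))"

locale tensor_product = V: vectorspace K V + W: vectorspace K W
  for K :: "('k, 'r) ring_scheme"
    and V :: "('k, 'a, 's) module_scheme"
    and W :: "('k, 'b, 't) module_scheme"
begin

abbreviation gen :: "'a \<Rightarrow> 'b \<Rightarrow> 'a \<times> 'b \<Rightarrow> 'k"
  where "gen x y \<equiv> free_gen K (carrier V \<times> carrier W) (x, y)"

lemma vectorspace_tensor_free: "vectorspace K (tensor_free K V W)"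
  by (rule vectorspace_free_space) (rule V.field_axioms)

lemma gen_closed: "gen x y \<in> carrier (tensor_free K V W)"
  by (rule free_gen_closed) (rule V.field_axioms)

lemma tensor_relations_subset: "tensor_relations K V W \<subseteq> carrier (tensor_free K V W)"
proof -
  interpret F: vectorspace K "tensor_free K V W" by (rule vectorspace_tensor_free)
  show ?thesis
    by (auto simp: tensor_relations_def Let_def gen_closed)
qed

lemma submodule_tensor_null: "submodule K (tensor_null K V W) (tensor_free K V W)"
proof -
  interpret F: vectorspace K "tensor_free K V W" by (rule vectorspace_tensor_free)
  show ?thesis
    unfolding tensor_null_def using tensor_relations_subset by (rule F.span_is_submodule)
qed

lemma tensor_relation_null: "r \<in> tensor_relations K V W \<Longrightarrow> r \<in> tensor_null K V W"
proof -
  interpret F: vectorspace K "tensor_free K V W" by (rule vectorspace_tensor_free)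
  show "r \<in> tensor_relations K V W \<Longrightarrow> r \<in> tensor_null K V W"
    unfolding tensor_null_def using F.in_own_span[OF tensor_relations_subset] by blast
qed

lemma vectorspace_tensor: "vectorspace K (tensor K V W)"
  unfolding tensor_def using vectorspace_tensor_free submodule_tensor_null
  by (rule vectorspace_quotient_space)

lemma linear_map_tensor_coset:
  "linear_map K (tensor_free K V W) (tensor K V W)
     (\<lambda>f. tensor_null K V W +>\<^bsub>tensor_free K V W\<^esub> f)"
  unfolding tensor_def using vectorspace_tensor_free submodule_tensor_null
  by (rule linear_map_coset)

lemma tensor_coset_eqI:
  assumes "f \<in> carrier (tensor_free K V W)" and "g \<in> carrier (tensor_free K V W)"
    and "f \<ominus>\<^bsub>tensor_free K V W\<^esub> g \<in> tensor_relations K V W"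
  shows "tensor_null K V W +>\<^bsub>tensor_free K V W\<^esub> f = tensor_null K V W +>\<^bsub>tensor_free K V W\<^esub> g"
  using vectorspace_tensor_free submodule_tensor_null assms(2,1) tensor_relation_null[OF assms(3)]
  by (rule coset_eqI)

lemma pure_tensor_closed: "pure_tensor K V W x y \<in> carrier (tensor K V W)"
proof -
  interpret q: linear_map K "tensor_free K V W" "tensor K V W"
    "\<lambda>f. tensor_null K V W +>\<^bsub>tensor_free K V W\<^esub> f"
    by (rule linear_map_tensor_coset)
  show ?thesis
    unfolding pure_tensor_def by (intro q.T_im gen_closed)
qed

text \<open>Each of the four families of relations is one of the four identities that make up
  bilinearity.\<close>

lemma bilinear_pure_tensor: "bilinear_map K V W (tensor K V W) (pure_tensor K V W)"
proof -
  let ?F = "tensor_free K V W"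
  interpret F: vectorspace K ?F by (rule vectorspace_tensor_free)
  interpret q: linear_map K ?F "tensor K V W" "\<lambda>f. tensor_null K V W +>\<^bsub>?F\<^esub> f"
    by (rule linear_map_tensor_coset)
  have "pure_tensor K V W (x \<oplus>\<^bsub>V\<^esub> x') y =
      pure_tensor K V W x y \<oplus>\<^bsub>tensor K V W\<^esub> pure_tensor K V W x' y"
    if "x \<in> carrier V" "x' \<in> carrier V" "y \<in> carrier W" for x x' y
  proof -
    have "gen (x \<oplus>\<^bsub>V\<^esub> x') y \<ominus>\<^bsub>?F\<^esub> (gen x y \<oplus>\<^bsub>?F\<^esub> gen x' y) \<in> tensor_relations K V W"
      using that unfolding tensor_relations_def Let_def by blast
    from tensor_coset_eqI[OF _ _ this] show ?thesis
      by (simp add: pure_tensor_def gen_closed)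
  qed
  moreover have "pure_tensor K V W x (y \<oplus>\<^bsub>W\<^esub> y') =
      pure_tensor K V W x y \<oplus>\<^bsub>tensor K V W\<^esub> pure_tensor K V W x y'"
    if "x \<in> carrier V" "y \<in> carrier W" "y' \<in> carrier W" for x y y'
  proof -
    have "gen x (y \<oplus>\<^bsub>W\<^esub> y') \<ominus>\<^bsub>?F\<^esub> (gen x y \<oplus>\<^bsub>?F\<^esub> gen x y') \<in> tensor_relations K V W"
      using that unfolding tensor_relations_def Let_def by blast
    from tensor_coset_eqI[OF _ _ this] show ?thesis
      by (simp add: pure_tensor_def gen_closed)
  qed
  moreover have "pure_tensor K V W (c \<odot>\<^bsub>V\<^esub> x) y = c \<odot>\<^bsub>tensor K V W\<^esub> pure_tensor K V W x y"
    if "c \<in> carrier K" "x \<in> carrier V" "y \<in> carrier W" for c x y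
  proof -
    have "gen (c \<odot>\<^bsub>V\<^esub> x) y \<ominus>\<^bsub>?F\<^esub> c \<odot>\<^bsub>?F\<^esub> gen x y \<in> tensor_relations K V W"
      using that unfolding tensor_relations_def Let_def by blast
    from tensor_coset_eqI[OF _ _ this] show ?thesis
      using that by (simp add: pure_tensor_def gen_closed)
  qed
  moreover have "pure_tensor K V W x (c \<odot>\<^bsub>W\<^esub> y) = c \<odot>\<^bsub>tensor K V W\<^esub> pure_tensor K V W x y"
    if "c \<in> carrier K" "x \<in> carrier V" "y \<in> carrier W" for c x y
  proof -
    have "gen x (c \<odot>\<^bsub>W\<^esub> y) \<ominus>\<^bsub>?F\<^esub> c \<odot>\<^bsub>?F\<^esub> gen x y \<in> tensor_relations K V W"
      using that unfolding tensor_relations_def Let_def by blast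
    from tensor_coset_eqI[OF _ _ this] show ?thesis
      using that by (simp add: pure_tensor_def gen_closed)
  qed
  ultimately show ?thesis
    unfolding bilinear_map_def
    by (intro conjI ballI linear_mapI vectorspace_tensor pure_tensor_closed
        V.vectorspace_axioms W.vectorspace_axioms)
qed

lemma linear_map_pure_left:
  "y \<in> carrier W \<Longrightarrow> linear_map K V (tensor K V W) (\<lambda>x. pure_tensor K V W x y)"
  using bilinear_pure_tensor by (simp add: bilinear_map_def)

lemma linear_map_pure_right:
  "x \<in> carrier V \<Longrightarrow> linear_map K W (tensor K V W) (\<lambda>y. pure_tensor K V W x y)"
  using bilinear_pure_tensor by (simp add: bilinear_map_def)

text \<open>Scalar multiples need no separate case: \<open>c \<odot> (x \<otimes> y) = (c \<odot> x) \<otimes> y\<close> is again pure, and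
  so is \<open>0 = 0 \<otimes> 0\<close>.\<close>

lemma tensor_induct [consumes 1, case_names pure add]:
  assumes t: "t \<in> carrier (tensor K V W)"
    and pure: "\<And>x y. x \<in> carrier V \<Longrightarrow> y \<in> carrier W \<Longrightarrow> P (pure_tensor K V W x y)"
    and add: "\<And>s t. s \<in> carrier (tensor K V W) \<Longrightarrow> t \<in> carrier (tensor K V W) \<Longrightarrow>
      P s \<Longrightarrow> P t \<Longrightarrow> P (s \<oplus>\<^bsub>tensor K V W\<^esub> t)"
  shows "P t"
proof -
  let ?F = "tensor_free K V W"
  interpret F: vectorspace K ?F by (rule vectorspace_tensor_free)
  interpret q: linear_map K ?F "tensor K V W" "\<lambda>f. tensor_null K V W +>\<^bsub>?F\<^esub> f"
    by (rule linear_map_tensor_coset)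
  interpret zero_left: linear_map K V "tensor K V W" "\<lambda>x. pure_tensor K V W x \<zero>\<^bsub>W\<^esub>"
    by (rule linear_map_pure_left) simp
  obtain f where f: "f \<in> carrier ?F" and t_eq: "t = tensor_null K V W +>\<^bsub>?F\<^esub> f"
    using vectorspace_tensor_free submodule_tensor_null t[unfolded tensor_def]
    by (rule quotient_spaceE)
  from f have "P (tensor_null K V W +>\<^bsub>?F\<^esub> f)"
  proof (induction f rule: free_space_induct[OF V.field_axioms, consumes 1, case_names zero add])
    case zero
    have "tensor_null K V W +>\<^bsub>?F\<^esub> \<zero>\<^bsub>?F\<^esub> = pure_tensor K V W \<zero>\<^bsub>V\<^esub> \<zero>\<^bsub>W\<^esub>"
      by simp
    then show ?case
      using pure[of "\<zero>\<^bsub>V\<^esub>" "\<zero>\<^bsub>W\<^esub>"] by simp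
  next
    case (add c p g)
    obtain x y where p: "p = (x, y)" "x \<in> carrier V" "y \<in> carrier W"
      using add.hyps(2) by auto
    interpret left: linear_map K V "tensor K V W" "\<lambda>x. pure_tensor K V W x y"
      using p(3) by (rule linear_map_pure_left)
    have eq: "tensor_null K V W +>\<^bsub>?F\<^esub> (c \<odot>\<^bsub>?F\<^esub> gen x y \<oplus>\<^bsub>?F\<^esub> g) =
        pure_tensor K V W (c \<odot>\<^bsub>V\<^esub> x) y \<oplus>\<^bsub>tensor K V W\<^esub> (tensor_null K V W +>\<^bsub>?F\<^esub> g)"
      using add.hyps p by (simp add: gen_closed pure_tensor_def[of K V W x y])
    show ?case
      unfolding p(1) eq using add.hyps p
      by (intro assms(3) pure_tensor_closed q.T_im pure add.IH V.smult_closed)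
  qed
  then show ?thesis
    by (simp add: t_eq)
qed

text \<open>Extend \<open>b\<close> linearly to the free space; bilinearity says that the extension vanishes on
  the relations, hence on their span, so that it descends to the quotient.\<close>

lemma tensor_lift_exists:
  assumes "bilinear_map K V W U b"
  obtains h where "linear_map K (tensor K V W) U h"
    and "\<forall>x\<in>carrier V. \<forall>y\<in>carrier W. h (pure_tensor K V W x y) = b x y"
proof -
  let ?F = "tensor_free K V W"
  interpret F: vectorspace K ?F by (rule vectorspace_tensor_free)
  have left: "linear_map K V U (\<lambda>x. b x y)" if "y \<in> carrier W" for y
    using assms that by (simp add: bilinear_map_def)
  have right: "linear_map K W U (\<lambda>y. b x y)" if "x \<in> carrier V" for x
    using assms that by (simp add: bilinear_map_def)
  have U: "vectorspace K U"
    using left[OF W.zero_closed] by (simp add: linear_map_def)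
  interpret U: vectorspace K U by (rule U)
  have b: "b x y \<in> carrier U" if "x \<in> carrier V" "y \<in> carrier W" for x y
  proof -
    interpret b: linear_map K V U "\<lambda>x. b x y" by (rule left) fact
    show ?thesis using that by simp
  qed
  obtain h where h: "linear_map K ?F U h"
    and h_gen': "\<And>p. p \<in> carrier V \<times> carrier W \<Longrightarrow>
      h (free_gen K (carrier V \<times> carrier W) p) = (\<lambda>(x, y). b x y) p"
    by (rule free_space_lift[OF V.field_axioms U, of "carrier V \<times> carrier W" "\<lambda>(x, y). b x y"])
      (auto simp: b)
  have h_gen: "h (gen x y) = b x y" if "x \<in> carrier V" "y \<in> carrier W" for x y
    using h_gen'[of "(x, y)"] that by simp
  interpret h: linear_map K ?F U h by (rule h)
  have "tensor_relations K V W \<subseteq> h.ker"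
  proof
    fix r
    assume r: "r \<in> tensor_relations K V W"
    have "h r = \<zero>\<^bsub>U\<^esub>"
      using r unfolding tensor_relations_def Let_def
    proof (elim UnE CollectE exE conjE; hypsubst)
      fix x x' y
      assume prems: "x \<in> carrier V" "x' \<in> carrier V" "y \<in> carrier W"
      interpret b: linear_map K V U "\<lambda>x. b x y" by (intro left prems)
      show "h (gen (x \<oplus>\<^bsub>V\<^esub> x') y \<ominus>\<^bsub>?F\<^esub> (gen x y \<oplus>\<^bsub>?F\<^esub> gen x' y)) = \<zero>\<^bsub>U\<^esub>"
        using prems by (simp add: gen_closed h_gen)
    next
      fix x y y'
      assume prems: "x \<in> carrier V" "y \<in> carrier W" "y' \<in> carrier W"
      interpret b: linear_map K W U "\<lambda>y. b x y" by (intro right prems)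
      show "h (gen x (y \<oplus>\<^bsub>W\<^esub> y') \<ominus>\<^bsub>?F\<^esub> (gen x y \<oplus>\<^bsub>?F\<^esub> gen x y')) = \<zero>\<^bsub>U\<^esub>"
        using prems by (simp add: gen_closed h_gen)
    next
      fix c x y
      assume prems: "c \<in> carrier K" "x \<in> carrier V" "y \<in> carrier W"
      interpret b: linear_map K V U "\<lambda>x. b x y" by (intro left prems)
      show "h (gen (c \<odot>\<^bsub>V\<^esub> x) y \<ominus>\<^bsub>?F\<^esub> c \<odot>\<^bsub>?F\<^esub> gen x y) = \<zero>\<^bsub>U\<^esub>"
        using prems by (simp add: gen_closed h_gen)
    next
      fix c x y
      assume prems: "c \<in> carrier K" "x \<in> carrier V" "y \<in> carrier W"
      interpret b: linear_map K W U "\<lambda>y. b x y" by (intro right prems)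
      show "h (gen x (c \<odot>\<^bsub>W\<^esub> y) \<ominus>\<^bsub>?F\<^esub> c \<odot>\<^bsub>?F\<^esub> gen x y) = \<zero>\<^bsub>U\<^esub>"
        using prems by (simp add: gen_closed h_gen)
    qed
    then show "r \<in> h.ker"
      using r tensor_relations_subset by (auto simp: h.ker_def)
  qed
  then have "tensor_null K V W \<subseteq> h.ker"
    unfolding tensor_null_def using h.ker_is_submodule by (rule F.span_is_subset)
  then have ker: "h n = \<zero>\<^bsub>U\<^esub>" if "n \<in> tensor_null K V W" for n
    using that by (auto simp: h.ker_def)
  obtain g where g: "linear_map K (tensor K V W) U g"
    and g_coset: "\<And>f. f \<in> carrier ?F \<Longrightarrow> g (tensor_null K V W +>\<^bsub>?F\<^esub> f) = h f"
    using quotient_space_lift[OF vectorspace_tensor_free submodule_tensor_null h ker]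
    unfolding tensor_def by blast
  show thesis
    by (rule that[OF g]) (simp add: pure_tensor_def g_coset gen_closed h_gen)
qed

lemma tensor_linear_map_eqI:
  assumes f: "linear_map K (tensor K V W) U f" and g: "linear_map K (tensor K V W) U g"
    and eq: "\<And>x y. x \<in> carrier V \<Longrightarrow> y \<in> carrier W \<Longrightarrow>
      f (pure_tensor K V W x y) = g (pure_tensor K V W x y)"
    and t: "t \<in> carrier (tensor K V W)"
  shows "f t = g t"
proof -
  interpret f: linear_map K "tensor K V W" U f by (rule f)
  interpret g: linear_map K "tensor K V W" U g by (rule g)
  from t show ?thesis
    by (induction t rule: tensor_induct) (simp_all add: eq)
qed

text \<open>The definite description in \<open>tensor_lift\<close> denotes: a solution exists by
  \<open>tensor_lift_exists\<close>, and two solutions agree on pure tensors and hence on the carrier,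
  while extensionality makes them agree outside of it.\<close>

lemma tensor_lift_welldefined:
  assumes "bilinear_map K V W U b"
  shows "linear_map K (tensor K V W) U (tensor_lift K V W U b) \<and>
    (\<forall>x\<in>carrier V. \<forall>y\<in>carrier W. tensor_lift K V W U b (pure_tensor K V W x y) = b x y)"
proof -
  let ?T = "tensor K V W"
  let ?P = "\<lambda>h. h \<in> extensional (carrier ?T) \<and> linear_map K ?T U h \<and>
    (\<forall>x\<in>carrier V. \<forall>y\<in>carrier W. h (pure_tensor K V W x y) = b x y)"
  obtain h where h: "linear_map K ?T U h"
    and h_pure: "\<forall>x\<in>carrier V. \<forall>y\<in>carrier W. h (pure_tensor K V W x y) = b x y"
    using assms by (rule tensor_lift_exists)
  have "linear_map K ?T U (restrict h (carrier ?T))"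
    using h by (rule linear_map_cong) simp
  then have "?P (restrict h (carrier ?T))"
    using h_pure by (simp add: pure_tensor_closed)
  moreover have "f = g" if f: "?P f" and g: "?P g" for f g
  proof (rule extensionalityI)
    show "f t = g t" if "t \<in> carrier ?T" for t
      using f g that by (intro tensor_linear_map_eqI[of U f g t]) simp_all
    show "f \<in> extensional (carrier ?T)" "g \<in> extensional (carrier ?T)"
      using f g by simp_all
  qed
  ultimately have "\<exists>!h. ?P h"
    by blast
  from theI'[OF this] show ?thesis
    unfolding tensor_lift_def by blast
qed

lemmas linear_map_tensor_lift = tensor_lift_welldefined[THEN conjunct1]

lemma tensor_lift_pure:
  "bilinear_map K V W U b \<Longrightarrow> x \<in> carrier V \<Longrightarrow> y \<in> carrier W \<Longrightarrow>
   tensor_lift K V W U b (pure_tensor K V W x y) = b x y"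
  by (rule tensor_lift_welldefined[THEN conjunct2, rule_format])

text \<open>If a bilinear map depends linearly on a parameter, so does its lift. Applied to trilinear
  maps, this makes the nested lifts that define \<open>tensor_assoc\<close> and \<open>tensor_cycle\<close>
  well defined.\<close>

lemma linear_map_tensor_lift_param:
  assumes b: "\<And>p. p \<in> carrier P \<Longrightarrow> bilinear_map K V W U (b p)"
    and lin: "\<And>x y. x \<in> carrier V \<Longrightarrow> y \<in> carrier W \<Longrightarrow> linear_map K P U (\<lambda>p. b p x y)"
    and t: "t \<in> carrier (tensor K V W)"
  shows "linear_map K P U (\<lambda>p. tensor_lift K V W U (b p) t)"
  using t
proof (induction t rule: tensor_induct)
  case (pure x y)
  show ?case
    using lin[OF pure] by (rule linear_map_cong) (rule tensor_lift_pure[OF b pure])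
next
  case (add s t)
  show ?case
  proof (rule linear_map_cong[OF linear_map_add[OF add.IH]])
    fix p
    assume "p \<in> carrier P"
    then interpret lift: linear_map K "tensor K V W" U "tensor_lift K V W U (b p)"
      by (intro linear_map_tensor_lift b)
    show "tensor_lift K V W U (b p) (s \<oplus>\<^bsub>tensor K V W\<^esub> t) =
        tensor_lift K V W U (b p) s \<oplus>\<^bsub>U\<^esub> tensor_lift K V W U (b p) t"
      using add.hyps by simp
  qed
qed

end

subsection \<open>The tensor product of two linear maps\<close>

lemma bilinear_pure_tensor_maps:
  assumes f: "linear_map K V V' f" and g: "linear_map K W W' g"
  shows "bilinear_map K V W (tensor K V' W') (\<lambda>x y. pure_tensor K V' W' (f x) (g y))"
proof -
  interpret f: linear_map K V V' f by (rule f)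
  interpret g: linear_map K W W' g by (rule g)
  interpret T: tensor_product K V' W'
    by (intro tensor_product.intro f.W.vectorspace_axioms g.W.vectorspace_axioms)
  show ?thesis
    unfolding bilinear_map_def
    using linear_map_comp[OF f T.linear_map_pure_left] linear_map_comp[OF g T.linear_map_pure_right]
    by auto
qed

lemma
  assumes f: "linear_map K V V' f" and g: "linear_map K W W' g"
  shows linear_map_tensor_map:
      "linear_map K (tensor K V W) (tensor K V' W') (tensor_map K V W V' W' f g)"
    and tensor_map_pure: "x \<in> carrier V \<Longrightarrow> y \<in> carrier W \<Longrightarrow>
      tensor_map K V W V' W' f g (pure_tensor K V W x y) = pure_tensor K V' W' (f x) (g y)"
proof -
  interpret T: tensor_product K V W
    using f g by (simp add: tensor_product_def linear_map_def)
  show "linear_map K (tensor K V W) (tensor K V' W') (tensor_map K V W V' W' f g)"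
    unfolding tensor_map_def
    by (intro T.linear_map_tensor_lift bilinear_pure_tensor_maps f g)
  show "x \<in> carrier V \<Longrightarrow> y \<in> carrier W \<Longrightarrow>
      tensor_map K V W V' W' f g (pure_tensor K V W x y) = pure_tensor K V' W' (f x) (g y)"
    unfolding tensor_map_def
    by (rule T.tensor_lift_pure[OF bilinear_pure_tensor_maps[OF f g]])
qed


section \<open>Permuting the factors of tensor powers\<close>

context vectorspace
begin

interpretation LL: tensor_product K V V
  by (intro tensor_product.intro vectorspace_axioms)

interpretation T2: vectorspace K "tensor K V V"
  by (rule LL.vectorspace_tensor)

interpretation L_LL: tensor_product K V "tensor K V V"
  by (intro tensor_product.intro vectorspace_axioms LL.vectorspace_tensor)

interpretation LL_L: tensor_product K "tensor K V V" V
  by (intro tensor_product.intro vectorspace_axioms LL.vectorspace_tensor)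

interpretation T3: vectorspace K "tensor3 K V"
  by (rule L_LL.vectorspace_tensor)

lemma bilinear_flip: "bilinear_map K V V (tensor K V V) (\<lambda>x y. pure_tensor K V V y x)"
  using LL.linear_map_pure_left LL.linear_map_pure_right by (simp add: bilinear_map_def)

lemma linear_map_tensor_flip: "linear_map K (tensor K V V) (tensor K V V) (tensor_flip K V)"
  unfolding tensor_flip_def by (rule LL.linear_map_tensor_lift[OF bilinear_flip])

lemma tensor_flip_pure:
  "x \<in> carrier V \<Longrightarrow> y \<in> carrier V \<Longrightarrow>
   tensor_flip K V (pure_tensor K V V x y) = pure_tensor K V V y x"
  unfolding tensor_flip_def by (rule LL.tensor_lift_pure[OF bilinear_flip])

lemma
  assumes "x \<in> carrier V" and "y \<in> carrier V"
  shows linear_map_pure_tensor3_1: "linear_map K V (tensor3 K V) (\<lambda>z. pure_tensor3 K V z x y)"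
    and linear_map_pure_tensor3_2: "linear_map K V (tensor3 K V) (\<lambda>z. pure_tensor3 K V x z y)"
    and linear_map_pure_tensor3_3: "linear_map K V (tensor3 K V) (\<lambda>z. pure_tensor3 K V x y z)"
  using assms
    linear_map_comp[OF LL.linear_map_pure_left L_LL.linear_map_pure_right]
    linear_map_comp[OF LL.linear_map_pure_right L_LL.linear_map_pure_right]
  by (simp_all add: L_LL.linear_map_pure_left LL.pure_tensor_closed)

lemmas linear_map_pure_tensor3 =
  linear_map_pure_tensor3_1 linear_map_pure_tensor3_2 linear_map_pure_tensor3_3

lemma bilinear_assoc_inner:
  "z \<in> carrier V \<Longrightarrow> bilinear_map K V V (tensor3 K V) (\<lambda>x y. pure_tensor3 K V x y z)"
  by (simp add: bilinear_map_def linear_map_pure_tensor3)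

lemma bilinear_assoc:
  "bilinear_map K (tensor K V V) V (tensor3 K V)
     (\<lambda>t z. tensor_lift K V V (tensor3 K V) (\<lambda>x y. pure_tensor3 K V x y z) t)"
  unfolding bilinear_map_def
  by (auto intro!: LL.linear_map_tensor_lift LL.linear_map_tensor_lift_param bilinear_assoc_inner
      linear_map_pure_tensor3)

lemma linear_map_tensor_assoc:
  "linear_map K (tensor K (tensor K V V) V) (tensor3 K V) (tensor_assoc K V)"
  unfolding tensor_assoc_def by (rule LL_L.linear_map_tensor_lift[OF bilinear_assoc])

lemma tensor_assoc_pure:
  assumes "x \<in> carrier V" and "y \<in> carrier V" and "z \<in> carrier V"
  shows "tensor_assoc K V (pure_tensor K (tensor K V V) V (pure_tensor K V V x y) z) =
    pure_tensor3 K V x y z"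
  unfolding tensor_assoc_def
  using assms
  by (simp add: LL_L.tensor_lift_pure[OF bilinear_assoc] LL.pure_tensor_closed
      LL.tensor_lift_pure[OF bilinear_assoc_inner])

text \<open>The inner lift is the same as for \<open>tensor_assoc\<close>, with the two arguments of the outer map
  interchanged.\<close>

lemma bilinear_cycle:
  "bilinear_map K V (tensor K V V) (tensor3 K V)
     (\<lambda>x t. tensor_lift K V V (tensor3 K V) (\<lambda>y z. pure_tensor3 K V y z x) t)"
  using bilinear_assoc by (simp add: bilinear_map_def)

lemma linear_map_tensor_cycle: "linear_map K (tensor3 K V) (tensor3 K V) (tensor_cycle K V)"
  unfolding tensor_cycle_def by (rule L_LL.linear_map_tensor_lift[OF bilinear_cycle])

lemma tensor_cycle_pure:
  assumes "x \<in> carrier V" and "y \<in> carrier V" and "z \<in> carrier V"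
  shows "tensor_cycle K V (pure_tensor3 K V x y z) = pure_tensor3 K V y z x"
  unfolding tensor_cycle_def
  using assms
  by (simp add: L_LL.tensor_lift_pure[OF bilinear_cycle] LL.pure_tensor_closed
      LL.tensor_lift_pure[OF bilinear_assoc_inner])

text \<open>\<open>1 \<otimes> \<tau>\<close>, which acts on threefold tensors as the transposition of the last two factors\<close>

abbreviation flip_right where
  "flip_right \<equiv> tensor_map K V (tensor K V V) V (tensor K V V) (\<lambda>x. x) (tensor_flip K V)"

lemma linear_map_flip_right: "linear_map K (tensor3 K V) (tensor3 K V) flip_right"
  by (intro linear_map_tensor_map linear_map_ident vectorspace_axioms linear_map_tensor_flip)

lemma flip_right_pure:
  "x \<in> carrier V \<Longrightarrow> t \<in> carrier (tensor K V V) \<Longrightarrow>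
   flip_right (pure_tensor K V (tensor K V V) x t) =
     pure_tensor K V (tensor K V V) x (tensor_flip K V t)"
  by (intro tensor_map_pure linear_map_ident vectorspace_axioms linear_map_tensor_flip)

interpretation flip: linear_map K "tensor K V V" "tensor K V V" "tensor_flip K V"
  by (rule linear_map_tensor_flip)

interpretation assoc: linear_map K "tensor K (tensor K V V) V" "tensor3 K V" "tensor_assoc K V"
  by (rule linear_map_tensor_assoc)

interpretation cycle: linear_map K "tensor3 K V" "tensor3 K V" "tensor_cycle K V"
  by (rule linear_map_tensor_cycle)

interpretation flip_right: linear_map K "tensor3 K V" "tensor3 K V" flip_right
  by (rule linear_map_flip_right)

lemma tensor3_induct [consumes 1, case_names pure add]:
  assumes t: "t \<in> carrier (tensor3 K V)"
    and pure: "\<And>x y z. x \<in> carrier V \<Longrightarrow> y \<in> carrier V \<Longrightarrow> z \<in> carrier V \<Longrightarrow>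
      P (pure_tensor3 K V x y z)"
    and add: "\<And>s t. s \<in> carrier (tensor3 K V) \<Longrightarrow> t \<in> carrier (tensor3 K V) \<Longrightarrow>
      P s \<Longrightarrow> P t \<Longrightarrow> P (s \<oplus>\<^bsub>tensor3 K V\<^esub> t)"
  shows "P t"
  using t
proof (induction t rule: L_LL.tensor_induct)
  case (pure x s)
  interpret right: linear_map K "tensor K V V" "tensor3 K V"
    "\<lambda>s. pure_tensor K V (tensor K V V) x s"
    using pure(1) by (rule L_LL.linear_map_pure_right)
  from pure(2) show ?case
  proof (induction s rule: LL.tensor_induct)
    case (pure y z)
    with \<open>x \<in> carrier V\<close> show ?case by (rule assms(2))
  next
    case (add s t)
    then show ?case by (simp add: assms(3))
  qed
qed (rule add)

lemma tensor_flip_flip: "t \<in> carrier (tensor K V V) \<Longrightarrow> tensor_flip K V (tensor_flip K V t) = t"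
  by (induction t rule: LL.tensor_induct) (simp_all add: tensor_flip_pure)

lemma tensor_cycle_cycle_cycle:
  "t \<in> carrier (tensor3 K V) \<Longrightarrow>
   tensor_cycle K V (tensor_cycle K V (tensor_cycle K V t)) = t"
  by (induction t rule: tensor3_induct) (simp_all add: tensor_cycle_pure)

text \<open>In the symmetric group on three letters, conjugating the 3-cycle by a transposition inverts
  it; \<open>\<xi>\<^sup>2\<close> stands for \<open>\<xi>\<^sup>-\<^sup>1\<close>.\<close>

lemma flip_right_cycle_cycle:
  "t \<in> carrier (tensor3 K V) \<Longrightarrow>
   flip_right (tensor_cycle K V (tensor_cycle K V t)) = tensor_cycle K V (flip_right t)"
  by (induction t rule: tensor3_induct)
    (simp_all add: tensor_cycle_pure flip_right_pure tensor_flip_pure LL.pure_tensor_closed)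

definition cyclic_sum where
  "cyclic_sum t = t \<oplus>\<^bsub>tensor3 K V\<^esub> tensor_cycle K V t
     \<oplus>\<^bsub>tensor3 K V\<^esub> tensor_cycle K V (tensor_cycle K V t)"

lemma linear_map_cyclic_sum: "linear_map K (tensor3 K V) (tensor3 K V) cyclic_sum"
  unfolding cyclic_sum_def
  by (intro linear_map_add linear_map_ident linear_map_tensor_cycle L_LL.vectorspace_tensor
      linear_map_comp[OF linear_map_tensor_cycle linear_map_tensor_cycle])

lemma cyclic_sum_cycle:
  assumes "t \<in> carrier (tensor3 K V)"
  shows "cyclic_sum (tensor_cycle K V t) = cyclic_sum t"
proof -
  show ?thesis
    using assms by (simp add: cyclic_sum_def tensor_cycle_cycle_cycle T3.a_ac)
qed

interpretation cyclic_sum: linear_map K "tensor3 K V" "tensor3 K V" cyclic_sum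
  by (rule linear_map_cyclic_sum)

text \<open>The co-Jacobi identity as a statement about the action of permutations on an arbitrary
  threefold tensor. With \<open>S = 1 + \<xi> + \<xi>\<^sup>2\<close> and \<open>\<sigma> = 1 \<otimes> \<tau>\<close>, it is the vanishing of
  \<open>S (1 - \<sigma>) (1 - \<xi>\<^sup>2)\<close>. Since \<open>S \<xi> = S\<close>, the factor \<open>1 - \<xi>\<^sup>2\<close> is killed by \<open>S\<close>;
  moving it across \<open>\<sigma>\<close> with \<open>\<sigma> \<xi>\<^sup>2 = \<xi> \<sigma>\<close> turns the remaining term into
  \<open>S (1 - \<xi>) \<sigma> = 0\<close>.\<close>

lemma cyclic_sum_alternating:
  assumes t: "t \<in> carrier (tensor3 K V)"
    and u_def: "u = t \<ominus>\<^bsub>tensor3 K V\<^esub> tensor_cycle K V (tensor_cycle K V t)"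
  shows "cyclic_sum (u \<ominus>\<^bsub>tensor3 K V\<^esub> flip_right u) = \<zero>\<^bsub>tensor3 K V\<^esub>"
proof -
  have u: "u \<in> carrier (tensor3 K V)"
    using t by (simp add: u_def)
  have "cyclic_sum u = \<zero>\<^bsub>tensor3 K V\<^esub>"
    using t by (simp add: u_def cyclic_sum_cycle)
  moreover have "cyclic_sum (flip_right u) = \<zero>\<^bsub>tensor3 K V\<^esub>"
    using t by (simp add: u_def flip_right_cycle_cycle cyclic_sum_cycle)
  ultimately show ?thesis
    using u by simp
qed

lemma tensor_flip_tensor_map:
  assumes f: "linear_map K V V f" and g: "linear_map K V V g"
    and t: "t \<in> carrier (tensor K V V)"
  shows "tensor_flip K V (tensor_map K V V V V f g t) =
    tensor_map K V V V V g f (tensor_flip K V t)"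
proof -
  interpret f: linear_map K V V f by (rule f)
  interpret g: linear_map K V V g by (rule g)
  interpret fg: linear_map K "tensor K V V" "tensor K V V" "tensor_map K V V V V f g"
    using f g by (rule linear_map_tensor_map)
  interpret gf: linear_map K "tensor K V V" "tensor K V V" "tensor_map K V V V V g f"
    using g f by (rule linear_map_tensor_map)
  from t show ?thesis
    by (induction t rule: LL.tensor_induct)
      (simp_all add: tensor_flip_pure tensor_map_pure f g)
qed

subsection \<open>Interaction with a comultiplication\<close>

context
  fixes \<alpha> \<Delta>
  assumes \<alpha>: "linear_map K V V \<alpha>" and \<Delta>: "linear_map K V (tensor K V V) \<Delta>"
begin

interpretation \<alpha>: linear_map K V V \<alpha>
  by (rule \<alpha>)

interpretation \<Delta>: linear_map K V "tensor K V V" \<Delta>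
  by (rule \<Delta>)

interpretation \<alpha>\<Delta>: linear_map K "tensor K V V" "tensor3 K V" "tensor_map K V V V (tensor K V V) \<alpha> \<Delta>"
  using \<alpha> \<Delta> by (rule linear_map_tensor_map)

interpretation \<Delta>\<alpha>: linear_map K "tensor K V V" "tensor K (tensor K V V) V"
  "tensor_map K V V (tensor K V V) V \<Delta> \<alpha>"
  using \<Delta> \<alpha> by (rule linear_map_tensor_map)

lemma linear_map_cocommutator: "linear_map K V (tensor K V V) (cocommutator K V \<Delta>)"
  unfolding cocommutator_def
  by (intro linear_map_minus \<Delta> linear_map_comp[OF \<Delta> linear_map_tensor_flip])

interpretation \<alpha>C: linear_map K "tensor K V V" "tensor3 K V"
  "tensor_map K V V V (tensor K V V) \<alpha> (cocommutator K V \<Delta>)"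
  using \<alpha> linear_map_cocommutator by (rule linear_map_tensor_map)

lemma tensor_map_cocommutator:
  assumes "t \<in> carrier (tensor K V V)"
  shows "tensor_map K V V V (tensor K V V) \<alpha> (cocommutator K V \<Delta>) t =
    tensor_map K V V V (tensor K V V) \<alpha> \<Delta> t \<ominus>\<^bsub>tensor3 K V\<^esub>
    flip_right (tensor_map K V V V (tensor K V V) \<alpha> \<Delta> t)"
  using assms
proof (induction t rule: LL.tensor_induct)
  case (pure x y)
  interpret right: linear_map K "tensor K V V" "tensor3 K V"
    "\<lambda>s. pure_tensor K V (tensor K V V) (\<alpha> x) s"
    using pure(1) by (intro L_LL.linear_map_pure_right) simp
  show ?case
    using pure
    by (simp add: tensor_map_pure \<alpha> \<Delta> linear_map_cocommutator flip_right_pure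
        cocommutator_def[of K V \<Delta> y])
next
  case (add s t)
  then show ?case
    by (simp add: a_minus_def T3.minus_add T3.a_ac)
qed

text \<open>On \<open>x \<otimes> y\<close> both sides are \<open>\<alpha> y \<otimes> \<Delta> x\<close>: the right-hand side starts from
  \<open>\<Delta> x \<otimes> \<alpha> y\<close>, and two cyclic shifts bring the last factor to the front. This is what
  lets coassociativity turn the flipped half of the cocommutator into a cyclic shift of the
  other half.\<close>

lemma tensor_map_tensor_flip:
  assumes "t \<in> carrier (tensor K V V)"
  shows "tensor_map K V V V (tensor K V V) \<alpha> \<Delta> (tensor_flip K V t) =
    tensor_cycle K V (tensor_cycle K V (tensor_assoc K V
      (tensor_map K V V (tensor K V V) V \<Delta> \<alpha> t)))"
  using assms
proof (induction t rule: LL.tensor_induct)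
  case (pure x y)
  interpret left: linear_map K "tensor K V V" "tensor K (tensor K V V) V"
    "\<lambda>s. pure_tensor K (tensor K V V) V s (\<alpha> y)"
    using pure by (intro LL_L.linear_map_pure_left) simp
  interpret right: linear_map K "tensor K V V" "tensor3 K V"
    "\<lambda>s. pure_tensor K V (tensor K V V) (\<alpha> y) s"
    using pure by (intro L_LL.linear_map_pure_right) simp
  \<comment> \<open>The tensor \<open>\<Delta> x\<close> need not be pure; so the identity is first shown for every \<open>s\<close> in
    its place.\<close>
  have "pure_tensor K V (tensor K V V) (\<alpha> y) s =
      tensor_cycle K V (tensor_cycle K V (tensor_assoc K V
        (pure_tensor K (tensor K V V) V s (\<alpha> y))))" if "s \<in> carrier (tensor K V V)" for s
    using that pure
    by (induction s rule: LL.tensor_induct) (simp_all add: tensor_assoc_pure tensor_cycle_pure)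
  from this[of "\<Delta> x"] show ?case
    using pure by (simp add: tensor_flip_pure tensor_map_pure \<alpha> \<Delta>)
next
  case (add s t)
  then show ?case
    by simp
qed

end

end

section \<open>The cocommutator of a Hom-associative coderivation pair\<close>

theorem proposition4p5:
  fixes K :: "('k, 'r) ring_scheme"
    and L :: "('k, 'a, 's) module_scheme"
    and \<Delta> :: "'a \<Rightarrow> ('a \<times> 'a \<Rightarrow> 'k) set"
    and \<delta> :: "'a \<Rightarrow> 'a"
    and \<alpha> :: "'a \<Rightarrow> 'a"
  assumes "char_zero_field K"
    and "hom_asscoder_pair K L \<Delta> \<delta> \<alpha>"
  shows "hom_lie_coder_pair K L (cocommutator K L \<Delta>) \<delta> \<alpha>"
proof -
  let ?LL = "tensor K L L"
  let ?\<alpha>\<Delta> = "tensor_map K L L L ?LL \<alpha> \<Delta>"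
  interpret vectorspace K L
    using assms(2) by (simp add: hom_asscoder_pair_def)
  interpret LL: tensor_product K L L
    by (intro tensor_product.intro vectorspace_axioms)
  interpret T2: vectorspace K ?LL
    by (rule LL.vectorspace_tensor)
  interpret flip: linear_map K ?LL ?LL "tensor_flip K L"
    by (rule linear_map_tensor_flip)
  interpret pair: hom_asscoder_pair K L \<Delta> \<delta> \<alpha>
    by (rule assms(2))
  have \<Delta>: "linear_map K L ?LL \<Delta>" and \<delta>: "linear_map K L L \<delta>" and \<alpha>: "linear_map K L L \<alpha>"
    by (rule pair.Delta.linear_map_axioms pair.delta.linear_map_axioms
        pair.alpha.linear_map_axioms)+
  interpret \<alpha>\<Delta>: linear_map K ?LL "tensor3 K L" ?\<alpha>\<Delta>
    using \<alpha> \<Delta> by (rule linear_map_tensor_map)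
  interpret \<delta>\<alpha>: linear_map K ?LL ?LL "tensor_map K L L L L \<delta> \<alpha>"
    using \<delta> \<alpha> by (rule linear_map_tensor_map)
  interpret \<alpha>\<delta>: linear_map K ?LL ?LL "tensor_map K L L L L \<alpha> \<delta>"
    using \<alpha> \<delta> by (rule linear_map_tensor_map)
  show ?thesis
  proof (intro hom_lie_coder_pair.intro hom_lie_coder_pair_axioms.intro vectorspace_axioms \<delta> \<alpha>
      linear_map_cocommutator[OF \<alpha> \<Delta>])
    fix x
    assume x: "x \<in> carrier L"
    show "cocommutator K L \<Delta> x = \<ominus>\<^bsub>?LL\<^esub> tensor_flip K L (cocommutator K L \<Delta> x)"
      using x
      by (simp add: cocommutator_def tensor_flip_flip a_minus_def T2.minus_add T2.a_ac)
    \<comment> \<open>Coassociativity enters here: \<open>(\<alpha> \<otimes> \<Delta>) (\<tau> (\<Delta> x)) = \<xi>\<^sup>2 ((\<Delta> \<otimes> \<alpha>) (\<Delta> x)) = \<xi>\<^sup>2 ((\<alpha> \<otimes> \<Delta>) (\<Delta> x))\<close>.\<close>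
    have "?\<alpha>\<Delta> (cocommutator K L \<Delta> x) = ?\<alpha>\<Delta> (\<Delta> x) \<ominus>\<^bsub>tensor3 K L\<^esub>
        tensor_cycle K L (tensor_cycle K L (?\<alpha>\<Delta> (\<Delta> x)))"
      using x pair.hom_coassociative[OF x]
      by (simp add: cocommutator_def[of K L \<Delta> x] tensor_map_tensor_flip[OF \<alpha> \<Delta>])
    from cyclic_sum_alternating[OF _ this]
    show "(let t = tensor_map K L L L ?LL \<alpha> (cocommutator K L \<Delta>) (cocommutator K L \<Delta> x)
      in t \<oplus>\<^bsub>tensor3 K L\<^esub> tensor_cycle K L t
           \<oplus>\<^bsub>tensor3 K L\<^esub> tensor_cycle K L (tensor_cycle K L t)) = \<zero>\<^bsub>tensor3 K L\<^esub>"
      using x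
      by (simp add: tensor_map_cocommutator[OF \<alpha> \<Delta>] cyclic_sum_def Let_def
          cocommutator_def[of K L \<Delta> x])
  next
    have "\<Delta> (\<delta> x) = tensor_map K L L L L \<delta> \<alpha> (\<Delta> x) \<oplus>\<^bsub>?LL\<^esub> tensor_map K L L L L \<alpha> \<delta> (\<Delta> x)"
      if "x \<in> carrier L" for x
      using pair.coderivation that by (simp add: hom_coderivation_def)
    then show "hom_coderivation K L (cocommutator K L \<Delta>) \<delta> \<alpha>"
      by (simp add: hom_coderivation_def cocommutator_def tensor_flip_tensor_map \<delta> \<alpha>
          a_minus_def T2.minus_add T2.a_ac)
  qed
qed

end
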